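(* Fix the dimension $d$ and constants $a_1,\ldots,a_d>0$, and let $c<\frac{d-1}{\sum_{i=1}^d a_i}$. If $p=p(n)\in[0,1]$ satisfies $p\le\frac{c\log n}{n}$ and $p=\omega(n^{-d})$ (i.e. $p\,n^d\to\infty$), then, asymptotically almost surely as $n\to\infty$, the random site subgraph of the Hamming torus contains isolated vertices and is thus not connected.
   Context: The $d$-dimensional Hamming torus (with parameters $a_1,\ldots,a_d>0$ and $n$) is the graph with vertex set $V=\{(x_1,\ldots,x_d)\in\mathbb{Z}^d: 1\le x_i\le a_i n,\ i=1,\ldots,d\}$ in which two vertices are adjacent exactly when they differ in exactly one coordinate (Hamming distance one). The random site subgraph with parameter $p$ is the induced subgraph obtained by independently keeping each vertex (calling it occupied) with probability $p$ and removing it, together with all incident edges, with probability $1-p$. An isolated vertex of the subgraph is an occupied vertex none of whose neighbors is occupied. "Asymptotically almost surely" means with probability tending to $1$ as $n\to\infty$, with $d,a_1,\ldots,a_d,c$ fixed. *)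

theory Defs
  imports "HOL-Probability.Probability" "Graph_Theory.Digraph_Component"
begin

text \<open>
  As in \<open>Graph_Theory\<close>, an undirected simple graph is a symmetric, loop-free digraph whose arcs are
  pairs of vertices (locale \<^locale>\<open>graph\<close>). Points of \<open>\<int>\<^sup>d\<close> are functions in
  \<open>{1..d} \<rightarrow>\<^sub>E UNIV\<close>, with the fixed value \<^term>\<open>undefined\<close> outside \<open>{1..d}\<close>.
\<close>

definition hamming_torus_verts :: "nat \<Rightarrow> (nat \<Rightarrow> real) \<Rightarrow> nat \<Rightarrow> (nat \<Rightarrow> int) set" where
  "hamming_torus_verts d a n =
     {x \<in> {1..d} \<rightarrow>\<^sub>E UNIV. \<forall>i\<in>{1..d}. 1 \<le> x i \<and> real_of_int (x i) \<le> a i * real n}"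

definition hamming_torus ::
  "nat \<Rightarrow> (nat \<Rightarrow> real) \<Rightarrow> nat \<Rightarrow> (nat \<Rightarrow> int, (nat \<Rightarrow> int) \<times> (nat \<Rightarrow> int)) pre_digraph" where
  "hamming_torus d a n =
     \<lparr> verts = hamming_torus_verts d a n,
       arcs = {(x, y). x \<in> hamming_torus_verts d a n \<and> y \<in> hamming_torus_verts d a n \<and>
                       (\<exists>!i. i \<in> {1..d} \<and> x i \<noteq> y i)},
       tail = fst, head = snd \<rparr>"

text \<open>
  Each vertex of the finite graph \<open>G\<close> is kept independently with probability \<open>p\<close>. For \<open>p\<close> outside
  \<open>[0, 1]\<close>, \<^const>\<open>bernoulli_pmf\<close> silently clamps its parameter.
\<close>

definition site_subgraph_pmf :: "('v, 'e) pre_digraph \<Rightarrow> real \<Rightarrow> ('v, 'e) pre_digraph pmf" where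
  "site_subgraph_pmf G p =
     map_pmf (\<lambda>occ. induce_subgraph G {v \<in> verts G. occ v})
       (Pi_pmf (verts G) False (\<lambda>_. bernoulli_pmf p))"

definition isolated_vertex :: "('v, 'e) pre_digraph \<Rightarrow> 'v \<Rightarrow> bool" where
  "isolated_vertex G v \<longleftrightarrow> v \<in> verts G \<and> (\<forall>w. \<not> v \<rightarrow>\<^bsub>G\<^esub> w \<and> \<not> w \<rightarrow>\<^bsub>G\<^esub> v)"

lemma finite_hamming_torus_verts: "finite (hamming_torus_verts d a n)"
proof (rule finite_subset)
  show "hamming_torus_verts d a n \<subseteq> (\<Pi>\<^sub>E i\<in>{1..d}. {1..\<lfloor>a i * real n\<rfloor>})"
    by (auto simp: hamming_torus_verts_def le_floor_iff intro!: PiE_I)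
  show "finite (\<Pi>\<^sub>E i\<in>{1..d}. {1..\<lfloor>a i * real n\<rfloor>})"
    by (intro finite_PiE) auto
qed

lemma graph_hamming_torus: "graph (hamming_torus d a n)"
proof
  have "arcs (hamming_torus d a n) \<subseteq> hamming_torus_verts d a n \<times> hamming_torus_verts d a n"
    by (auto simp: hamming_torus_def)
  then show "finite (arcs (hamming_torus d a n))"
    by (rule finite_subset) (simp add: finite_hamming_torus_verts)
  show "finite (verts (hamming_torus d a n))"
    by (simp add: hamming_torus_def finite_hamming_torus_verts)
  show "symmetric (hamming_torus d a n)"
    unfolding symmetric_def arcs_ends_conv
    by (auto simp: hamming_torus_def sym_def image_def)
qed (auto simp: hamming_torus_def arc_to_ends_def)

end

theory Submission
  imports Defs "HOL-Real_Asymp.Real_Asymp"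
begin

text \<open>
  Second moment method for the number of isolated vertices. Its mean tends to infinity. The isolation
  events of two adjacent vertices are disjoint, and two distinct non-adjacent vertices have at most \<open>d\<close>
  common neighbours, so their joint isolation probability is at most the product of the individual
  ones times \<open>(1 - p)\<^sup>-\<^sup>d\<close>, which tends to 1. By Chebyshev's inequality there are a.a.s. at
  least two isolated vertices. One would not suffice, since a graph with a single vertex is connected.
\<close>

section \<open>Second moment bound for the occurrence of two events\<close>

text \<open>Chebyshev for the number \<open>X\<close> of events that occur: the correlation bound
  gives \<open>variance X\<close> at most \<mu> + (K - 1) \<mu>^2, and division by (\<mu>/2)^2
  yields the error term.\<close>

lemma (in prob_space) prob_two_events_ge:
  fixes A :: "'i \<Rightarrow> 'a set"
  assumes fin: "finite V" and A: "\<And>v. v \<in> V \<Longrightarrow> A v \<in> events"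
    and \<mu>: "\<mu> = (\<Sum>v\<in>V. prob (A v))" "\<mu> \<ge> 4" and K: "K \<ge> 0"
    and cor: "\<And>v w. v \<in> V \<Longrightarrow> w \<in> V \<Longrightarrow> v \<noteq> w \<Longrightarrow> prob (A v \<inter> A w) \<le> K * (prob (A v) * prob (A w))"
  shows "prob {x\<in>space M. \<exists>v\<in>V. \<exists>w\<in>V. v \<noteq> w \<and> x \<in> A v \<and> x \<in> A w} \<ge> 1 - 4 * (1 / \<mu> + (K - 1))"
proof -
  define X where "X x = (\<Sum>v\<in>V. indicat_real (A v) x)" for x
  have X2: "X x ^ 2 = (\<Sum>v\<in>V. \<Sum>w\<in>V. indicat_real (A v \<inter> A w) x)" for x
    by (simp add: X_def power2_eq_square sum_product indicator_inter_arith)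
  have int: "integrable M (indicat_real (A v))" if "v \<in> V" for v
    using A[OF that] by (simp add: emeasure_eq_measure)
  have int2: "integrable M (indicat_real (A v \<inter> A w))" if "v \<in> V" "w \<in> V" for v w
    using A that by (simp add: emeasure_eq_measure)
  have intX: "integrable M X" and intX2: "integrable M (\<lambda>x. X x ^ 2)"
    unfolding X2 unfolding X_def using int int2 by (auto intro!: Bochner_Integration.integrable_sum)
  have EX: "expectation X = \<mu>"
    unfolding X_def \<mu>(1) using int A
    by (subst Bochner_Integration.integral_sum) (auto intro!: sum.cong simp: Int_absorb2 sets.sets_into_space)
  have "expectation (\<lambda>x. X x ^ 2) = (\<Sum>v\<in>V. \<Sum>w\<in>V. prob (A v \<inter> A w))"
    unfolding X2 using int2 A
    by (subst Bochner_Integration.integral_sum)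
       (auto intro!: sum.cong Bochner_Integration.integrable_sum simp: Bochner_Integration.integral_sum Int_absorb2 sets.sets_into_space le_infI1)
  \<comment> \<open>The correlation bound covers only distinct indices. Keeping the nonnegative
    \<open>K\<close> term on the diagonal too makes that part of the double sum factor as K
    \<mu>^2.\<close>
  also have "\<dots> \<le> (\<Sum>v\<in>V. \<Sum>w\<in>V. (if w = v then prob (A v) else 0) + K * (prob (A v) * prob (A w)))"
    using cor K by (intro sum_mono) auto
  also have "\<dots> = \<mu> + K * \<mu>\<^sup>2"
    using fin by (simp add: sum.distrib \<mu>(1) power2_eq_square sum_product flip: sum_distrib_left)
  finally have "variance X \<le> \<mu> + (K - 1) * \<mu>\<^sup>2"
    using variance_eq[OF intX intX2] EX by (simp add: algebra_simps)
  then have "variance X / (\<mu> / 2)\<^sup>2 \<le> (\<mu> + (K - 1) * \<mu>\<^sup>2) / (\<mu> / 2)\<^sup>2"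
    by (rule divide_right_mono) simp
  also have "\<dots> = 4 * (1 / \<mu> + (K - 1))"
    using \<mu>(2) by (simp add: field_simps power2_eq_square)
  finally have cheb: "prob {x\<in>space M. \<mu> / 2 \<le> \<bar>X x - \<mu>\<bar>} \<le> 4 * (1 / \<mu> + (K - 1))"
    using Chebyshev_inequality[of X "\<mu> / 2"] intX intX2 \<mu>(2) EX by auto
  let ?E = "{x\<in>space M. \<exists>v\<in>V. \<exists>w\<in>V. v \<noteq> w \<and> x \<in> A v \<and> x \<in> A w}"
  let ?D = "{x\<in>space M. \<mu> / 2 \<le> \<bar>X x - \<mu>\<bar>}"
  have D: "?D \<in> events"
    using borel_measurable_integrable[OF intX] by measurable
  have "?E = space M \<inter> (\<Union>v\<in>V. \<Union>w\<in>V - {v}. A v \<inter> A w)"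
    by auto
  also have "\<dots> \<in> events"
    using fin A by auto
  finally have E: "?E \<in> events" .
  \<comment> \<open>Off \<open>?D\<close> the count exceeds \<mu>/2, which is at least 2, so at
    least two events occur.\<close>
  have "space M - ?D \<subseteq> ?E"
  proof
    fix x assume x: "x \<in> space M - ?D"
    then have "X x > 1"
      using \<mu>(2) by (auto simp: abs_if split: if_splits)
    moreover have "X x = real (card {v\<in>V. x \<in> A v})"
      using fin by (simp add: X_def indicator_def sum.If_cases Int_def)
    ultimately have "Suc 0 < card {v\<in>V. x \<in> A v}"
      by simp
    then show "x \<in> ?E"
      using x fin by (auto simp: card_le_Suc0_iff_eq not_le[symmetric])
  qed
  then have "prob (space M - ?D) \<le> prob ?E"
    using E by (rule finite_measure_mono)
  then show ?thesis
    using prob_compl[OF D] cheb by simp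
qed

section \<open>Isolated vertices in the site subgraph of a finite graph\<close>

text \<open>The event is a product set \<open>Pi V B\<close>, so independence turns its probability
  into a product over \<open>V\<close>, in which unconstrained coordinates contribute 1.\<close>

lemma prob_Pi_bernoulli_cylinder:
  fixes p :: real
  assumes fin: "finite V" and sub: "S \<subseteq> V" "T \<subseteq> V" "S \<inter> T = {}" and p: "0 \<le> p" "p \<le> 1"
  shows "measure_pmf.prob (Pi_pmf V dflt (\<lambda>_. bernoulli_pmf p)) {f. (\<forall>x\<in>S. f x) \<and> (\<forall>x\<in>T. \<not> f x)}
           = p ^ card S * (1 - p) ^ card T"
proof -
  define B where "B x = (if x \<in> S then {True} else if x \<in> T then {False} else UNIV)" for x
  have "{f. (\<forall>x\<in>S. f x) \<and> (\<forall>x\<in>T. \<not> f x)} = Pi V B"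
    using sub by (fastforce simp: Pi_def B_def split: if_splits)
  then have "measure_pmf.prob (Pi_pmf V dflt (\<lambda>_. bernoulli_pmf p)) {f. (\<forall>x\<in>S. f x) \<and> (\<forall>x\<in>T. \<not> f x)}
      = (\<Prod>x\<in>V. measure_pmf.prob (bernoulli_pmf p) (B x))"
    using fin by (simp add: measure_Pi_pmf_Pi)
  also have "\<dots> = (\<Prod>x\<in>S \<union> T. measure_pmf.prob (bernoulli_pmf p) (B x))"
    using fin sub by (intro prod.mono_neutral_right) (auto simp: B_def)
  also have "\<dots> = (\<Prod>x\<in>S. measure_pmf.prob (bernoulli_pmf p) (B x)) *
      (\<Prod>x\<in>T. measure_pmf.prob (bernoulli_pmf p) (B x))"
    using fin sub by (intro prod.union_disjoint) (auto intro: finite_subset)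
  also have "(\<Prod>x\<in>S. measure_pmf.prob (bernoulli_pmf p) (B x)) = (\<Prod>x\<in>S. p)"
    using p by (intro prod.cong) (auto simp: B_def measure_pmf_single)
  also have "(\<Prod>x\<in>T. measure_pmf.prob (bernoulli_pmf p) (B x)) = (\<Prod>x\<in>T. 1 - p)"
    using p sub(3) by (intro prod.cong) (auto simp: B_def measure_pmf_single)
  finally show ?thesis
    by simp
qed

text \<open>Connectedness means reachability in the symmetrised digraph. A path from
  \<open>v\<close> to another vertex has a first arc, which comes from an arc of \<open>G\<close>
  into or out of \<open>v\<close>; isolation forbids both directions.\<close>

lemma isolated_vertices_not_connected:
  assumes "isolated_vertex G v" "isolated_vertex G w" "v \<noteq> w"
  shows "\<not> Digraph_Component.connected G"
proof
  assume "Digraph_Component.connected G"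
  then have "v \<rightarrow>\<^sup>*\<^bsub>with_proj (mk_symmetric G)\<^esub> w"
    using assms by (auto simp: connected_def strongly_connected_def isolated_vertex_def)
  then obtain u where "v \<rightarrow>\<^bsub>with_proj (mk_symmetric G)\<^esub> u"
    using assms(3) by (rule_tac pre_digraph.converse_reachable_cases) auto
  then show False
    using assms(1) by (auto simp: isolated_vertex_def parcs_mk_symmetric arcs_ends_conv)
qed

text \<open>Rewrites isolation as a cylinder event of the occupation variables. Symmetry of the arcs
  reduces the two directions to one.\<close>

lemma (in graph) isolated_vertex_induce_subgraph:
  "isolated_vertex (G \<restriction> {v \<in> verts G. occ v}) v \<longleftrightarrow>
     v \<in> verts G \<and> occ v \<and> (\<forall>w. v \<rightarrow>\<^bsub>G\<^esub> w \<longrightarrow> \<not> occ w)"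
proof -
  have "v \<rightarrow>\<^bsub>G \<restriction> {v \<in> verts G. occ v}\<^esub> w \<longleftrightarrow> v \<rightarrow>\<^bsub>G\<^esub> w \<and> occ v \<and> occ w" for v w
    by (fastforce simp: arcs_ends_conv image_iff)
  moreover have "v \<rightarrow>\<^bsub>G\<^esub> w \<longleftrightarrow> w \<rightarrow>\<^bsub>G\<^esub> v" for w
    using sym_arcs by (meson arcs_ends_symmetric)
  ultimately show ?thesis
    by (auto simp: isolated_vertex_def)
qed


text \<open>The second moment bound with \<open>K\<close> equal to 1 / (1 - p)^k. Stating it with a
  mere lower bound \<open>\<mu>\<close> for the mean allows non-regular graphs and rough estimates
  of the degree.\<close>

lemma (in graph) prob_isolated_disconnected_ge:
  fixes p \<mu> :: real
  assumes p: "0 \<le> p" "p < 1"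
    and deg: "\<And>v. v \<in> verts G \<Longrightarrow> card {w. v \<rightarrow> w} \<le> D"
    and common: "\<And>v w. v \<in> verts G \<Longrightarrow> w \<in> verts G \<Longrightarrow> v \<noteq> w \<Longrightarrow> \<not> v \<rightarrow> w \<Longrightarrow>
      card {u. v \<rightarrow> u \<and> w \<rightarrow> u} \<le> k"
    and \<mu>: "4 \<le> \<mu>" "\<mu> \<le> real (card (verts G)) * (p * (1 - p) ^ D)"
  shows "measure_pmf.prob (site_subgraph_pmf G p)
      {H. (\<exists>v. isolated_vertex H v) \<and> \<not> Digraph_Component.connected H} \<ge>
    1 - 4 * (1 / \<mu> + (1 / (1 - p) ^ k - 1))"
proof -
  define M where "M = Pi_pmf (verts G) False (\<lambda>_. bernoulli_pmf p)"
  define N where "N v = {w. v \<rightarrow> w}" for v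
  define A where "A v = {occ. (\<forall>x\<in>{v}. occ x) \<and> (\<forall>x\<in>N v. \<not> occ x)}" for v
  have sub: "N v \<subseteq> verts G" for v
    by (auto simp: N_def adj_in_verts)
  have fin: "finite (N v)" for v
    using sub by (rule finite_subset) simp
  have notin: "v \<notin> N v" for v
    by (auto simp: N_def dest: adj_not_same)
  have prob_A: "measure_pmf.prob M (A v) = p * (1 - p) ^ card (N v)" if "v \<in> verts G" for v
    using prob_Pi_bernoulli_cylinder[of "verts G" "{v}" "N v" p False] that sub notin p
    by (simp add: M_def A_def)
  have cor: "measure_pmf.prob M (A v \<inter> A w) \<le>
      1 / (1 - p) ^ k * (measure_pmf.prob M (A v) * measure_pmf.prob M (A w))"
    if vw: "v \<in> verts G" "w \<in> verts G" "v \<noteq> w" for v w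
  proof (cases "v \<rightarrow> w")
    case True
    then have "A v \<inter> A w = {}"
      by (auto simp: A_def N_def)
    then show ?thesis
      using p by simp
  next
    case False
    then have "\<not> w \<rightarrow> v"
      using sym_arcs by (meson arcs_ends_symmetric)
    then have disj: "{v, w} \<inter> (N v \<union> N w) = {}"
      using False notin by (auto simp: N_def)
    have "A v \<inter> A w = {occ. (\<forall>x\<in>{v, w}. occ x) \<and> (\<forall>x\<in>N v \<union> N w. \<not> occ x)}"
      by (auto simp: A_def)
    then have "measure_pmf.prob M (A v \<inter> A w) = p\<^sup>2 * (1 - p) ^ card (N v \<union> N w)"
      using prob_Pi_bernoulli_cylinder[of "verts G" "{v, w}" "N v \<union> N w" p False] vw sub disj p
      by (simp add: M_def power2_eq_square)
    \<comment> \<open>Only common neighbours are counted twice in the product of the individual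
      probabilities, so by inclusion-exclusion the exponents differ by at most
      \<open>k\<close>.\<close>
    moreover have "(1 - p) ^ card (N v \<union> N w) * (1 - p) ^ k \<le> (1 - p) ^ card (N v) * (1 - p) ^ card (N w)"
    proof -
      have "N v \<inter> N w = {u. v \<rightarrow> u \<and> w \<rightarrow> u}"
        by (auto simp: N_def)
      then have "card (N v) + card (N w) \<le> card (N v \<union> N w) + k"
        using card_Un_Int[OF fin fin, of v w] common[OF vw False] by simp
      then show ?thesis
        unfolding power_add[symmetric] using p by (intro power_decreasing) auto
    qed
    then have "(1 - p) ^ card (N v \<union> N w) \<le> (1 - p) ^ card (N v) * (1 - p) ^ card (N w) / (1 - p) ^ k"
      using p by (subst pos_le_divide_eq) auto
    then have "p\<^sup>2 * (1 - p) ^ card (N v \<union> N w) \<le>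
        p\<^sup>2 * ((1 - p) ^ card (N v) * (1 - p) ^ card (N w) / (1 - p) ^ k)"
      by (rule mult_left_mono) simp
    ultimately show ?thesis
      using vw by (simp add: prob_A power2_eq_square mult_ac)
  qed
  define \<nu> where "\<nu> = (\<Sum>v\<in>verts G. measure_pmf.prob M (A v))"
  have "(\<Sum>v\<in>verts G. p * (1 - p) ^ D) \<le> \<nu>"
    unfolding \<nu>_def using p deg
    by (intro sum_mono) (auto simp: prob_A N_def intro!: mult_left_mono power_decreasing)
  then have \<nu>: "\<mu> \<le> \<nu>"
    using \<mu> by simp
  \<comment> \<open>The bound increases with the mean, so the true mean \<open>\<nu>\<close> may
    replace \<open>\<mu>\<close>.\<close>
  have "1 - 4 * (1 / \<mu> + (1 / (1 - p) ^ k - 1)) \<le> 1 - 4 * (1 / \<nu> + (1 / (1 - p) ^ k - 1))"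
    using \<mu> \<nu> by (simp add: frac_le)
  also have "\<dots> \<le> measure_pmf.prob M {occ \<in> space M. \<exists>v\<in>verts G. \<exists>w\<in>verts G. v \<noteq> w \<and> occ \<in> A v \<and> occ \<in> A w}"
    using p \<mu> \<nu> cor by (intro measure_pmf.prob_two_events_ge) (auto simp: \<nu>_def)
  also have "\<dots> \<le> measure_pmf.prob M {occ. (\<exists>v. isolated_vertex (G \<restriction> {v \<in> verts G. occ v}) v) \<and>
      \<not> Digraph_Component.connected (G \<restriction> {v \<in> verts G. occ v})}"
  proof (intro measure_pmf.finite_measure_mono subsetI)
    fix occ assume "occ \<in> {occ \<in> space M. \<exists>v\<in>verts G. \<exists>w\<in>verts G. v \<noteq> w \<and> occ \<in> A v \<and> occ \<in> A w}"
    then obtain v w where vw: "v \<noteq> w" "v \<in> verts G" "w \<in> verts G" "occ \<in> A v" "occ \<in> A w"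
      by auto
    then have iso: "isolated_vertex (G \<restriction> {v \<in> verts G. occ v}) v" "isolated_vertex (G \<restriction> {v \<in> verts G. occ v}) w"
      by (auto simp: isolated_vertex_induce_subgraph A_def N_def)
    then show "occ \<in> {occ. (\<exists>v. isolated_vertex (G \<restriction> {v \<in> verts G. occ v}) v) \<and>
        \<not> Digraph_Component.connected (G \<restriction> {v \<in> verts G. occ v})}"
      using iso(1) isolated_vertices_not_connected[OF iso vw(1)] by (intro CollectI conjI exI)
  qed simp
  also have "\<dots> = measure_pmf.prob (site_subgraph_pmf G p)
      {H. (\<exists>v. isolated_vertex H v) \<and> \<not> Digraph_Component.connected H}"
    by (simp add: site_subgraph_pmf_def M_def vimage_def)
  finally show ?thesis .
qed

section \<open>Degrees and common neighbours in the Hamming torus\<close>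

lemma hamming_torus_verts_eq_PiE:
  "hamming_torus_verts d a n = (\<Pi>\<^sub>E i\<in>{1..d}. {1..\<lfloor>a i * real n\<rfloor>})"
  by (rule set_eqI) (simp add: hamming_torus_verts_def le_floor_iff PiE_iff conj_commute)

lemma hamming_torus_adj_iff:
  "v \<rightarrow>\<^bsub>hamming_torus d a n\<^esub> w \<longleftrightarrow>
     v \<in> hamming_torus_verts d a n \<and> w \<in> hamming_torus_verts d a n \<and> (\<exists>!i. i \<in> {1..d} \<and> v i \<noteq> w i)"
  by (simp add: hamming_torus_def arcs_ends_conv)

text \<open>Presents neighbours as one-coordinate updates, the form in which both counts below
  enumerate them. Equality of functions must also be checked outside \<open>{1..d}\<close>, where
  both points are \<open>undefined\<close>.\<close>

lemma hamming_torus_adj_upd: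
  assumes "v \<rightarrow>\<^bsub>hamming_torus d a n\<^esub> w"
  obtains i where "i \<in> {1..d}" "v i \<noteq> w i" "w = v(i := w i)" "w i \<in> {1..\<lfloor>a i * real n\<rfloor>}"
proof -
  have vw: "v \<in> hamming_torus_verts d a n" "w \<in> hamming_torus_verts d a n"
    and ex: "\<exists>!i. i \<in> {1..d} \<and> v i \<noteq> w i"
    using assms by (auto simp: hamming_torus_adj_iff)
  from ex obtain i where i: "i \<in> {1..d}" "v i \<noteq> w i" "\<And>j. j \<in> {1..d} \<Longrightarrow> v j \<noteq> w j \<Longrightarrow> j = i"
    by blast
  have "w j = (v(i := w i)) j" for j
  proof (cases "j \<in> {1..d}")
    case True
    then have "v j = w j" if "j \<noteq> i"
      using i(3) that by blast
    then show ?thesis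
      by simp
  next
    case False
    then have "v j = undefined" "w j = undefined"
      using vw[unfolded hamming_torus_verts_eq_PiE] by (blast intro: PiE_arb)+
    then show ?thesis
      using False i(1) by auto
  qed
  then have "w = v(i := w i)" ..
  moreover have "w i \<in> {1..\<lfloor>a i * real n\<rfloor>}"
    using vw(2) i(1) unfolding hamming_torus_verts_eq_PiE by (rule PiE_mem)
  ultimately show thesis
    by (rule that[OF i(1,2)])
qed

text \<open>Every neighbour arises by choosing a coordinate and a new value for it. The old value is
  counted as well, a harmless excess.\<close>

lemma hamming_torus_degree_le:
  "card {w. v \<rightarrow>\<^bsub>hamming_torus d a n\<^esub> w} \<le> (\<Sum>i=1..d. nat \<lfloor>a i * real n\<rfloor>)"
proof -
  let ?S = "\<lambda>i. (\<lambda>y. v(i := y)) ` {1..\<lfloor>a i * real n\<rfloor>}"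
  have "{w. v \<rightarrow>\<^bsub>hamming_torus d a n\<^esub> w} \<subseteq> (\<Union>i\<in>{1..d}. ?S i)"
    by (auto elim!: hamming_torus_adj_upd)
  then have "card {w. v \<rightarrow>\<^bsub>hamming_torus d a n\<^esub> w} \<le> card (\<Union>i\<in>{1..d}. ?S i)"
    by (intro card_mono) auto
  also have "\<dots> \<le> (\<Sum>i=1..d. card (?S i))"
    by (rule card_UN_le) simp
  also have "\<dots> \<le> (\<Sum>i=1..d. nat \<lfloor>a i * real n\<rfloor>)"
    by (intro sum_mono order.trans[OF card_image_le]) auto
  finally show ?thesis .
qed

text \<open>A common neighbour changes \<open>v\<close> in a coordinate \<open>i\<close> and
  \<open>w\<close> in a coordinate \<open>j\<close>. If i = j, then \<open>v\<close> and
  \<open>w\<close> would agree off \<open>i\<close> and be adjacent. Hence \<open>u\<close> agrees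
  with \<open>w\<close> at \<open>i\<close>, so \<open>i\<close> alone determines \<open>u\<close>.
  Any bound independent of \<open>n\<close> would serve.\<close>

lemma hamming_torus_common_neighbours_le:
  assumes "v \<noteq> w" "\<not> v \<rightarrow>\<^bsub>hamming_torus d a n\<^esub> w"
  shows "card {u. v \<rightarrow>\<^bsub>hamming_torus d a n\<^esub> u \<and> w \<rightarrow>\<^bsub>hamming_torus d a n\<^esub> u} \<le> d"
proof -
  have "{u. v \<rightarrow>\<^bsub>hamming_torus d a n\<^esub> u \<and> w \<rightarrow>\<^bsub>hamming_torus d a n\<^esub> u} \<subseteq> (\<lambda>i. v(i := w i)) ` {1..d}"
  proof safe
    fix u assume vu: "v \<rightarrow>\<^bsub>hamming_torus d a n\<^esub> u" and wu: "w \<rightarrow>\<^bsub>hamming_torus d a n\<^esub> u"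
    obtain i where i: "i \<in> {1..d}" "u = v(i := u i)"
      using vu by (rule hamming_torus_adj_upd)
    obtain j where j: "j \<in> {1..d}" "u = w(j := u j)"
      using wu by (rule hamming_torus_adj_upd)
    have "i \<noteq> j"
    proof
      assume "i = j"
      then have eq: "v k = w k" if "k \<noteq> i" for k
        using i j that by (metis fun_upd_apply)
      then have "v i \<noteq> w i"
        using \<open>v \<noteq> w\<close> by (metis ext)
      then have "\<exists>!k. k \<in> {1..d} \<and> v k \<noteq> w k"
        using i(1) eq by (intro ex1I[of _ i]) auto
      then have "v \<rightarrow>\<^bsub>hamming_torus d a n\<^esub> w"
        using vu wu by (simp add: hamming_torus_adj_iff)
      then show False
        using assms(2) by contradiction
    qed
    then have "u i = w i"
      using fun_cong[OF j(2), of i] by simp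
    from i(2)[unfolded this] i(1) show "u \<in> (\<lambda>i. v(i := w i)) ` {1..d}"
      by (rule image_eqI)
  qed
  then have "card {u. v \<rightarrow>\<^bsub>hamming_torus d a n\<^esub> u \<and> w \<rightarrow>\<^bsub>hamming_torus d a n\<^esub> u} \<le> card {1..d}"
    by (meson card_image_le card_mono finite_atLeastAtMost finite_imageI order.trans)
  then show ?thesis
    by simp
qed


section \<open>Asymptotics of the expected number of isolated vertices\<close>

text \<open>Rounding down costs at most a factor 2 per coordinate: for y at least 2, the floor of y
  exceeds y - 1, which is at least y/2.\<close>

lemma hamming_torus_card_verts_ge:
  fixes a :: "nat \<Rightarrow> real"
  assumes a: "\<And>i. i \<in> {1..d} \<Longrightarrow> a i > 0"
  shows "\<forall>\<^sub>F n in sequentially. (\<Prod>i=1..d. a i / 2) * real n ^ d \<le> real (card (hamming_torus_verts d a n))"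
proof -
  have "\<forall>\<^sub>F n in sequentially. 2 \<le> a i * real n" if "i \<in> {1..d}" for i
    using a[OF that] by real_asymp
  then have "\<forall>\<^sub>F n in sequentially. \<forall>i\<in>{1..d}. 2 \<le> a i * real n"
    by (simp add: eventually_ball_finite_distrib)
  then show ?thesis
  proof eventually_elim
    case (elim n)
    have "(\<Prod>i=1..d. a i / 2) * real n ^ d = (\<Prod>i=1..d. a i / 2 * real n)"
      unfolding prod.distrib by simp
    also have "\<dots> \<le> (\<Prod>i=1..d. real (nat \<lfloor>a i * real n\<rfloor>))"
    proof (intro prod_mono conjI)
      fix i assume "i \<in> {1..d}"
      then have "2 \<le> a i * real n"
        using elim by blast
      then show "0 \<le> a i / 2 * real n" "a i / 2 * real n \<le> real (nat \<lfloor>a i * real n\<rfloor>)"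
        by linarith+
    qed
    also have "\<dots> = real (card (\<Pi>\<^sub>E i\<in>{1..d}. {1..\<lfloor>a i * real n\<rfloor>}))"
      by (simp add: card_PiE)
    finally show ?case
      by (simp add: hamming_torus_verts_eq_PiE)
  qed
qed

text \<open>Rests on ln (1 - p) being at least -p - 2 p^2 for p in [0, 1/2]. Enlarging the exponent
  from \<open>m\<close> to \<open>M\<close> only decreases the left side.\<close>

lemma exp_le_one_minus_power:
  fixes p :: real
  assumes "0 \<le> p" "p \<le> 1 / 2" "real m \<le> M"
  shows "exp (- M * (p + 2 * p\<^sup>2)) \<le> (1 - p) ^ m"
proof -
  have "exp (- M * (p + 2 * p\<^sup>2)) \<le> exp (real m * (- p - 2 * p\<^sup>2))"
    using assms mult_right_mono[OF assms(3), of "p + 2 * p\<^sup>2"] by (simp add: algebra_simps)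
  also have "\<dots> \<le> exp (real m * ln (1 - p))"
    using assms by (simp add: ln_one_minus_pos_lower_bound mult_left_mono)
  also have "\<dots> = (1 - p) ^ m"
    using assms by (simp add: exp_of_nat_mult)
  finally show ?thesis .
qed

text \<open>
  The map \<open>p \<mapsto> p * exp (- A * n * p)\<close> is unimodal, so over the whole range of \<open>p\<close> it is bounded below by its
  values at the two ends; \<open>p = 1 / n\<close> separates the two regimes.
\<close>
lemma expected_isolated_at_top:
  fixes A B c :: real and p :: "nat \<Rightarrow> real"
  assumes A: "A > 0" and B: "B > 0" and c: "c * A < real d - 1"
    and p: "\<And>n. 0 \<le> p n" "\<forall>\<^sub>F n in sequentially. p n \<le> c * ln (real n) / real n"
    and lim: "filterlim (\<lambda>n. p n * real n ^ d) at_top sequentially"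
  shows "filterlim (\<lambda>n. B * real n ^ d * (p n * exp (- (A * real n) * (p n + 2 * (p n)\<^sup>2)))) at_top sequentially"
proof -
  \<comment> \<open>The factor \<open>exp (- 1)\<close> pays for the quadratic term 2 A n p^2 in the
    exponent; the two arguments of \<open>min\<close> are the lower bounds for n p at most 1 and for
    n p above 1.\<close>
  define g where "g n = B * exp (- 1) * min (exp (- A) * (p n * real n ^ d)) (real n powr (real d - 1 - c * A))" for n
  have "filterlim (\<lambda>n. exp (- A) * (p n * real n ^ d)) at_top sequentially"
    by (rule filterlim_tendsto_pos_mult_at_top[OF tendsto_const _ lim]) simp
  moreover have "filterlim (\<lambda>n. real n powr (real d - 1 - c * A)) at_top sequentially"
    using c by real_asymp
  ultimately have "filterlim (\<lambda>n. min (exp (- A) * (p n * real n ^ d)) (real n powr (real d - 1 - c * A))) at_top sequentially"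
    by (simp add: filterlim_at_top eventually_conj_iff)
  then have g: "filterlim g at_top sequentially"
    unfolding g_def using B by (intro filterlim_tendsto_pos_mult_at_top[OF tendsto_const]) auto
  \<comment> \<open>At the largest admissible \<open>p\<close> the quadratic term has order (ln n)^2
    / n, hence is eventually at most 1.\<close>
  have "\<forall>\<^sub>F n in sequentially. A * real n * (2 * (c * ln (real n) / real n)\<^sup>2) \<le> 1"
  proof -
    have "(\<lambda>n. real n * (ln (real n) / real n)\<^sup>2) \<longlonglongrightarrow> 0"
      by real_asymp
    then have "(\<lambda>n. 2 * A * c\<^sup>2 * (real n * (ln (real n) / real n)\<^sup>2)) \<longlonglongrightarrow> 0"
      by (rule tendsto_mult_right_zero)
    then have "\<forall>\<^sub>F n in sequentially. 2 * A * c\<^sup>2 * (real n * (ln (real n) / real n)\<^sup>2) < 1"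
      by (rule order_tendstoD) simp
    then show ?thesis
      by eventually_elim (simp add: power_mult_distrib power_divide mult_ac)
  qed
  moreover have "\<forall>\<^sub>F n in sequentially. n > 0"
    by (rule eventually_gt_at_top)
  ultimately have "\<forall>\<^sub>F n in sequentially. g n \<le> B * real n ^ d * (p n * exp (- (A * real n) * (p n + 2 * (p n)\<^sup>2)))"
    using p(2)
  proof eventually_elim
    case (elim n)
    have "A * real n * (2 * (p n)\<^sup>2) \<le> A * real n * (2 * (c * ln (real n) / real n)\<^sup>2)"
      using A p(1)[of n] elim by (intro mult_left_mono power_mono) auto
    then have "exp (- 1) * exp (- (A * real n * p n)) \<le> exp (- (A * real n) * (p n + 2 * (p n)\<^sup>2))"
      using elim by (simp add: algebra_simps flip: exp_add)
    then have "B * real n ^ d * (p n * (exp (- 1) * exp (- (A * real n * p n)))) \<le>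
        B * real n ^ d * (p n * exp (- (A * real n) * (p n + 2 * (p n)\<^sup>2)))"
      using p(1)[of n] B by (intro mult_left_mono) auto
    moreover have "min (exp (- A) * (p n * real n ^ d)) (real n powr (real d - 1 - c * A)) \<le>
        real n ^ d * p n * exp (- (A * real n * p n))"
    proof (cases "real n * p n \<le> 1")
      case True
      then have "A * (real n * p n) \<le> A * 1"
        using A by (intro mult_left_mono) auto
      then have "real n ^ d * p n * exp (- A) \<le> real n ^ d * p n * exp (- (A * real n * p n))"
        using p(1)[of n] by (intro mult_left_mono) auto
      then show ?thesis
        by (simp add: algebra_simps min_def)
    next
      case False
      \<comment> \<open>For n p > 1, the upper bound on \<open>p\<close> makes the exponential at
        least n^(-cA), while n^d p is at least n^(d-1). The product has the exponent d - 1 - cA,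
        positive by the choice of \<open>c\<close>.\<close>
      have "A * (real n * p n) \<le> A * (c * ln (real n))"
        using A elim by (intro mult_left_mono) (auto simp: field_simps)
      then have "exp (- (c * A) * ln (real n)) \<le> exp (- (A * real n * p n))"
        by (simp add: algebra_simps)
      moreover have "real n powr (real d - 1) \<le> real n ^ d * p n"
        using False elim by (simp add: powr_diff powr_realpow field_simps mult_left_mono)
      ultimately have "real n powr (real d - 1) * exp (- (c * A) * ln (real n)) \<le>
          real n ^ d * p n * exp (- (A * real n * p n))"
        using p(1)[of n] by (intro mult_mono) auto
      moreover have "real n powr (real d - 1) * exp (- (c * A) * ln (real n)) = real n powr (real d - 1 - c * A)"
        using elim by (simp add: powr_def algebra_simps flip: exp_add)
      ultimately show ?thesis
        by simp
    qed
    then have "B * exp (- 1) * min (exp (- A) * (p n * real n ^ d)) (real n powr (real d - 1 - c * A)) \<le>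
        B * exp (- 1) * (real n ^ d * p n * exp (- (A * real n * p n)))"
      using B by (intro mult_left_mono) auto
    ultimately show ?case
      by (simp add: g_def mult_ac)
  qed
  with g show ?thesis
    by (rule filterlim_at_top_mono)
qed

section \<open>Passage to the limit in n\<close>

theorem theorem1p4:
  fixes d :: nat and a :: "nat \<Rightarrow> real" and c :: real and p :: "nat \<Rightarrow> real"
  assumes "d \<ge> 1"
    and "\<And>i. i \<in> {1..d} \<Longrightarrow> a i > 0"
    and "c < (real d - 1) / (\<Sum>i=1..d. a i)"
    and "\<And>n. 0 \<le> p n \<and> p n \<le> 1"
    and "\<forall>\<^sub>F n in sequentially. p n \<le> c * ln (real n) / real n"
    and "filterlim (\<lambda>n. p n * real n ^ d) at_top sequentially"
  shows "(\<lambda>n. measure_pmf.prob (site_subgraph_pmf (hamming_torus d a n) (p n))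
            {H. (\<exists>v. isolated_vertex H v) \<and> \<not> Digraph_Component.connected H}) \<longlonglongrightarrow> 1"
proof -
  \<comment> \<open>A n bounds all degrees and B n^d is eventually a lower bound for the number of
    vertices, so \<open>\<mu> n\<close> is eventually a lower bound for the expected number of
    isolated vertices.\<close>
  define A where "A = (\<Sum>i=1..d. a i)"
  define B where "B = (\<Prod>i=1..d. a i / 2)"
  define \<mu> where "\<mu> n = B * real n ^ d * (p n * exp (- (A * real n) * (p n + 2 * (p n)\<^sup>2)))" for n
  have A: "A > 0"
    unfolding A_def using assms(1,2) by (intro sum_pos) auto
  have B: "B > 0"
    unfolding B_def using assms(2) by (intro prod_pos) auto
  have "c * A < real d - 1"
    using assms(3) A by (simp add: A_def field_simps)
  then have \<mu>: "filterlim \<mu> at_top sequentially"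
    unfolding \<mu>_def using A B assms(4-6) by (intro expected_isolated_at_top) auto
  have "(\<lambda>n. c * (ln (real n) / real n)) \<longlonglongrightarrow> 0"
    by (rule tendsto_mult_right_zero) real_asymp
  \<comment> \<open>Used twice: \<open>p n\<close> is eventually below 1/2, as the exponential
    estimate requires, and the correlation factor 1 / (1 - p)^d tends to 1.\<close>
  then have p0: "p \<longlonglongrightarrow> 0"
    using assms(4,5) by (intro tendsto_sandwich[of "\<lambda>_. 0" p sequentially "\<lambda>n. c * (ln (real n) / real n)"]) auto
  let ?P = "\<lambda>n. measure_pmf.prob (site_subgraph_pmf (hamming_torus d a n) (p n))
            {H. (\<exists>v. isolated_vertex H v) \<and> \<not> Digraph_Component.connected H}"
  have "\<forall>\<^sub>F n in sequentially. B * real n ^ d \<le> real (card (hamming_torus_verts d a n))"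
    unfolding B_def using assms(2) by (rule hamming_torus_card_verts_ge)
  then have lower: "\<forall>\<^sub>F n in sequentially. 1 - 4 * (1 / \<mu> n + (1 / (1 - p n) ^ d - 1)) \<le> ?P n"
    using filterlim_at_top[THEN iffD1, OF \<mu>, rule_format, of 4] order_tendstoD(2)[OF p0, of "1 / 2", simplified]
  proof eventually_elim
    case (elim n)
    define D where "D = (\<Sum>i=1..d. nat \<lfloor>a i * real n\<rfloor>)"
    have "real D \<le> (\<Sum>i=1..d. a i * real n)"
      unfolding D_def of_nat_sum using assms(2) by (intro sum_mono) (simp add: less_imp_le)
    then have "real D \<le> A * real n"
      by (simp add: A_def sum_distrib_right)
    then have "exp (- (A * real n) * (p n + 2 * (p n)\<^sup>2)) \<le> (1 - p n) ^ D"
      using assms(4)[of n] elim by (intro exp_le_one_minus_power) auto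
    then have "\<mu> n \<le> real (card (hamming_torus_verts d a n)) * (p n * (1 - p n) ^ D)"
      unfolding \<mu>_def using elim assms(4)[of n] B by (intro mult_mono) auto
    moreover have "verts (hamming_torus d a n) = hamming_torus_verts d a n"
      by (simp add: hamming_torus_def)
    ultimately show ?case
      using assms(4)[of n] elim hamming_torus_degree_le hamming_torus_common_neighbours_le
      by (intro graph.prob_isolated_disconnected_ge[OF graph_hamming_torus, where D = D]) (auto simp: D_def)
  qed
  \<comment> \<open>Both error terms vanish: the first because \<open>\<mu>\<close> diverges, the
    second because \<open>p\<close> tends to 0 with \<open>d\<close> fixed.\<close>
  have "(\<lambda>n. 1 - 4 * (1 / \<mu> n + (1 / (1 - p n) ^ d - 1))) \<longlonglongrightarrow> 1 - 4 * (0 + (1 / (1 - 0) ^ d - 1))"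
    using p0 tendsto_divide_0[OF tendsto_const filterlim_at_top_imp_at_infinity[OF \<mu>], of 1]
    by (intro tendsto_intros) auto
  then have lim: "(\<lambda>n. 1 - 4 * (1 / \<mu> n + (1 / (1 - p n) ^ d - 1))) \<longlonglongrightarrow> 1"
    by simp
  show ?thesis
    by (rule tendsto_sandwich[OF lower _ lim tendsto_const]) simp
qed

end
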